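(* Let $\langle G,\varepsilon\rangle$ be a (discrete) bidding game with game structure $G=\langle S,s_0,T,g,u_1,u_2\rangle$ and resolution $\varepsilon=1/R'$, $R'$ a positive integer. Then $\langle G,\varepsilon\rangle$ has a pure subgame-perfect equilibrium (PSPE). Further, if for all $s_j\in g(s_0)$ there is a PSPE $\gamma^{(j)}$ in $\langle G|_{s_j},\varepsilon\rangle$, then there is a PSPE $\gamma'$ in $\langle G,\varepsilon\rangle$ such that for all $s_j\in g(s_0)$, $\gamma'|_{s_j}=\gamma^{(j)}$.
   Context: A (two-player, impartial) game structure is $G=\langle S,s_0,T,g,u_1,u_2\rangle$ with a finite set of states $S$, initial state $s_0\in S$, terminals $T\subseteq S$, a move function $g$ assigning to each $s\in S\setminus T$ a nonempty set $g(s)\subseteq S$ of next states available to both players (the directed graph so defined has no cycles), and utilities $u_i:T\to\mathbb R$, $i=1,2$. $G|_s$ is the subgame rooted at $s$. Bidding game $\langle G,\varepsilon\rangle$, $\varepsilon=1/R'$: budgets and bids are in $\mathcal B_\varepsilon=\{0,\varepsilon,2\varepsilon,\dots,1\}$. A budget partition is $(B_1,B_2)$ with $B_1+B_2=1$, identified with $B_1\in\mathcal B_\varepsilon$. At state $s\in S\setminus T$ with budgets $(B_1,B_2)$, each player $i$ simultaneously submits a bid $b_i\in\mathcal B_\varepsilon$ with $b_i\le B_i$ and a next state $s_i^*\in g(s)$. The higher bidder wins, ties being won by player 1; the winner pays her bid to the other player, and the game moves to the state selected by the winner with the updated budgets. The game ends at a terminal. A (valid) strategy profile $\gamma$ specifies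 bids and next states of both players for every $s\in S\setminus T$ and every $B_1\in\mathcal B_\varepsilon$; $\gamma|_s$ is its restriction to the subgame rooted at $s$. It is a PSPE if for every $s$ and every $B_1$ each player's strategy is a best response to the other's in the subgame starting from $(s,B_1)$; equivalently, for every $(s,B_1)$, no player can obtain a terminal with strictly larger utility by changing only her own bid and/or next state at $(s,B_1)$.
   Formalization: In the second part, the given PSPEs γ^(j) are additionally required to agree on positions shared by different subgames G|_{s_j}; without this the claim fails on acyclic graphs with shared states, and it is automatic for trees. *)

theory Defs
  imports Complex_Main "HOL-Library.FuncSet"
begin

record 'a game =
  states :: "'a set"
  init :: 'a
  terminals :: "'a set"
  moves :: "'a \<Rightarrow> 'a set"
  util1 :: "'a \<Rightarrow> real"
  util2 :: "'a \<Rightarrow> real"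

text \<open>The values of \<open>moves\<close> on terminals and of the utilities off the terminals are never used.\<close>

definition edges :: "'a game \<Rightarrow> ('a \<times> 'a) set" where
  "edges G = {(s, s'). s \<in> states G - terminals G \<and> s' \<in> moves G s}"

definition game_structure :: "'a game \<Rightarrow> bool" where
  "game_structure G \<longleftrightarrow>
     finite (states G) \<and> init G \<in> states G \<and> terminals G \<subseteq> states G \<and>
     (\<forall>s \<in> states G - terminals G. moves G s \<noteq> {} \<and> moves G s \<subseteq> states G) \<and>
     acyclic (edges G)"

definition subgame :: "'a game \<Rightarrow> 'a \<Rightarrow> 'a game" where
  "subgame G s =
     G\<lparr>states := (edges G)\<^sup>* `` {s}, init := s,
       terminals := terminals G \<inter> (edges G)\<^sup>* `` {s}\<rparr>"

text \<open>For \<open>\<epsilon> = 1 / R\<close> with \<open>R\<close> a positive integer this is \<open>{0, \<epsilon>, 2\<epsilon>, \<dots>, 1}\<close>.\<close>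

definition bid_grid :: "real \<Rightarrow> real set" where
  "bid_grid \<epsilon> = {real k * \<epsilon> |k. real k * \<epsilon> \<le> 1}"

text \<open>A position is a state together with the budget \<open>B\<close> of player 1; player 2 holds \<open>1 - B\<close>.
  A strategy maps each non-terminal position to a bid and a next state.  Strategies are extensional,
  so that equality of (restricted) strategies is equality on the positions they are defined on.\<close>

type_synonym 'a strategy = "'a \<times> real \<Rightarrow> real \<times> 'a"
type_synonym 'a profile = "'a strategy \<times> 'a strategy"

definition positions :: "'a game \<Rightarrow> real \<Rightarrow> ('a \<times> real) set" where
  "positions G \<epsilon> = (states G - terminals G) \<times> bid_grid \<epsilon>"

definition strategies1 :: "'a game \<Rightarrow> real \<Rightarrow> 'a strategy set" where
  "strategies1 G \<epsilon> = (\<Pi>\<^sub>E (s, B) \<in> positions G \<epsilon>. {b \<in> bid_grid \<epsilon>. b \<le> B} \<times> moves G s)"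

definition strategies2 :: "'a game \<Rightarrow> real \<Rightarrow> 'a strategy set" where
  "strategies2 G \<epsilon> = (\<Pi>\<^sub>E (s, B) \<in> positions G \<epsilon>. {b \<in> bid_grid \<epsilon>. b \<le> 1 - B} \<times> moves G s)"

definition profiles :: "'a game \<Rightarrow> real \<Rightarrow> 'a profile set" where
  "profiles G \<epsilon> = strategies1 G \<epsilon> \<times> strategies2 G \<epsilon>"

definition restrict_profile :: "('a \<times> real) set \<Rightarrow> 'a profile \<Rightarrow> 'a profile" where
  "restrict_profile P \<gamma> = (restrict (fst \<gamma>) P, restrict (snd \<gamma>) P)"

definition subgame_profile :: "'a game \<Rightarrow> real \<Rightarrow> 'a profile \<Rightarrow> 'a \<Rightarrow> 'a profile" where
  "subgame_profile G \<epsilon> \<gamma> s = restrict_profile (positions (subgame G s) \<epsilon>) \<gamma>"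

fun play_step :: "'a game \<Rightarrow> 'a profile \<Rightarrow> 'a \<times> real \<Rightarrow> 'a \<times> real" where
  "play_step G (\<sigma>1, \<sigma>2) (s, B) =
     (if s \<in> terminals G then (s, B)
      else let (b1, n1) = \<sigma>1 (s, B); (b2, n2) = \<sigma>2 (s, B)
           in if b1 \<ge> b2 then (n1, B - b1) else (n2, B + b2))"

text \<open>The terminal reached from the initial state; it exists and is unique,
  see \<open>outcome_well_defined\<close> below.\<close>

definition outcome :: "'a game \<Rightarrow> 'a profile \<Rightarrow> real \<Rightarrow> 'a" where
  "outcome G \<gamma> B =
     (THE t. t \<in> terminals G \<and> (\<exists>n. fst ((play_step G \<gamma> ^^ n) (init G, B)) = t))"

definition equilibrium :: "'a game \<Rightarrow> real \<Rightarrow> real \<Rightarrow> 'a profile \<Rightarrow> bool" where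
  "equilibrium G \<epsilon> B \<gamma> \<longleftrightarrow>
     (\<forall>\<tau> \<in> strategies1 G \<epsilon>. util1 G (outcome G (\<tau>, snd \<gamma>) B) \<le> util1 G (outcome G \<gamma> B)) \<and>
     (\<forall>\<tau> \<in> strategies2 G \<epsilon>. util2 G (outcome G (fst \<gamma>, \<tau>) B) \<le> util2 G (outcome G \<gamma> B))"

definition PSPE :: "'a game \<Rightarrow> real \<Rightarrow> 'a profile \<Rightarrow> bool" where
  "PSPE G \<epsilon> \<gamma> \<longleftrightarrow>
     \<gamma> \<in> profiles G \<epsilon> \<and>
     (\<forall>s \<in> states G. \<forall>B \<in> bid_grid \<epsilon>. equilibrium (subgame G s) \<epsilon> B (subgame_profile G \<epsilon> \<gamma> s))"

lemma reachable_in_states: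
  assumes "game_structure G" "s \<in> states G" "(s, s') \<in> (edges G)\<^sup>*"
  shows "s' \<in> states G"
  using assms(3,2,1)
  by (induction rule: rtrancl_induct) (auto simp: edges_def game_structure_def)

lemma game_structure_subgame:
  assumes "game_structure G" "s \<in> states G"
  shows "game_structure (subgame G s)"
proof -
  let ?S = "(edges G)\<^sup>* `` {s}"
  have sub: "?S \<subseteq> states G"
    using reachable_in_states[OF assms] by auto
  have "edges (subgame G s) \<subseteq> edges G"
    using sub by (auto simp: edges_def subgame_def)
  then have "acyclic (edges (subgame G s))"
    using assms(1) unfolding game_structure_def by (metis acyclic_subset)
  moreover have "moves G x \<noteq> {} \<and> moves G x \<subseteq> ?S" if "x \<in> ?S - terminals G" for x
  proof -
    have x: "x \<in> states G - terminals G" using that sub by auto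
    then have "moves G x \<subseteq> edges G `` {x}" by (auto simp: edges_def)
    moreover have "(s, x) \<in> (edges G)\<^sup>*" using that by auto
    ultimately have "moves G x \<subseteq> ?S" by (meson Image_singleton_iff rtrancl.rtrancl_into_rtrancl subset_iff)
    then show ?thesis using x assms(1) unfolding game_structure_def by blast
  qed
  moreover have "finite ?S"
    using sub assms(1) unfolding game_structure_def by (metis finite_subset)
  ultimately show ?thesis
    unfolding game_structure_def[of "subgame G s"] by (auto simp: subgame_def)
qed

lemma bid_grid_diff:
  assumes "\<epsilon> > 0" "x \<in> bid_grid \<epsilon>" "y \<in> bid_grid \<epsilon>" "y \<le> x"
  shows "x - y \<in> bid_grid \<epsilon>"
proof -
  obtain k l where k: "x = real k * \<epsilon>" "x \<le> 1" and l: "y = real l * \<epsilon>"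
    using assms by (auto simp: bid_grid_def)
  then have "l \<le> k" using assms by auto
  then have "x - y = real (k - l) * \<epsilon>" using k l by (simp add: of_nat_diff algebra_simps)
  moreover have "y \<ge> 0" using l assms(1) by simp
  ultimately show ?thesis using k unfolding bid_grid_def by (smt (verit) mem_Collect_eq)
qed

lemma bid_grid_add:
  assumes "x \<in> bid_grid \<epsilon>" "y \<in> bid_grid \<epsilon>" "y \<le> 1 - x"
  shows "x + y \<in> bid_grid \<epsilon>"
proof -
  obtain k l where "x = real k * \<epsilon>" "y = real l * \<epsilon>"
    using assms by (auto simp: bid_grid_def)
  then have "x + y = real (k + l) * \<epsilon>" by (simp add: algebra_simps)
  then show ?thesis using assms(3) unfolding bid_grid_def by (smt (verit) mem_Collect_eq)
qed

lemma play_step_edge: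
  assumes "\<epsilon> > 0" "\<gamma> \<in> profiles G \<epsilon>" "s \<in> states G - terminals G" "B \<in> bid_grid \<epsilon>"
  shows "(s, fst (play_step G \<gamma> (s, B))) \<in> edges G" "snd (play_step G \<gamma> (s, B)) \<in> bid_grid \<epsilon>"
proof -
  obtain \<sigma>1 \<sigma>2 where \<gamma>: "\<gamma> = (\<sigma>1, \<sigma>2)" by force
  have p: "(s, B) \<in> positions G \<epsilon>" using assms by (auto simp: positions_def)
  have \<sigma>1: "\<sigma>1 \<in> strategies1 G \<epsilon>" and \<sigma>2: "\<sigma>2 \<in> strategies2 G \<epsilon>"
    using assms(2) unfolding \<gamma> profiles_def by auto
  obtain b1 n1 where 1: "\<sigma>1 (s, B) = (b1, n1)" by force
  obtain b2 n2 where 2: "\<sigma>2 (s, B) = (b2, n2)" by force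
  have b1: "b1 \<in> bid_grid \<epsilon>" "b1 \<le> B" "n1 \<in> moves G s"
    using PiE_mem[OF \<sigma>1[unfolded strategies1_def] p] by (simp_all add: 1)
  have b2: "b2 \<in> bid_grid \<epsilon>" "b2 \<le> 1 - B" "n2 \<in> moves G s"
    using PiE_mem[OF \<sigma>2[unfolded strategies2_def] p] by (simp_all add: 2)
  have step: "play_step G \<gamma> (s, B) = (if b1 \<ge> b2 then (n1, B - b1) else (n2, B + b2))"
    using assms(3) by (simp add: \<gamma> 1 2)
  show "(s, fst (play_step G \<gamma> (s, B))) \<in> edges G"
    using assms(3) b1(3) b2(3) by (simp add: step edges_def)
  show "snd (play_step G \<gamma> (s, B)) \<in> bid_grid \<epsilon>"
    using bid_grid_diff[OF assms(1,4) b1(1,2)] bid_grid_add[OF assms(4) b2(1,2)]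
    by (simp add: step)
qed

lemma play_step_terminal:
  assumes "s \<in> terminals G"
  shows "(play_step G \<gamma> ^^ n) (s, B) = (s, B)"
  using assms by (cases \<gamma>) (induction n; auto)

lemma outcome_well_defined:
  assumes G: "game_structure G" and \<epsilon>: "\<epsilon> > 0" and \<gamma>: "\<gamma> \<in> profiles G \<epsilon>"
    and B: "B \<in> bid_grid \<epsilon>"
  shows "\<exists>!t. t \<in> terminals G \<and> (\<exists>n. fst ((play_step G \<gamma> ^^ n) (init G, B)) = t)"
proof -
  let ?f = "play_step G \<gamma>"
  have "edges G \<subseteq> states G \<times> states G"
    using G by (auto simp: edges_def game_structure_def)
  then have "finite (edges G)"
    using G unfolding game_structure_def by (meson finite_SigmaI finite_subset)
  then have wf: "wf ((edges G)\<inverse>)"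
    using G unfolding game_structure_def by (simp add: finite_acyclic_wf_converse)
  have ex: "s \<in> states G \<Longrightarrow> B \<in> bid_grid \<epsilon> \<Longrightarrow> \<exists>n. fst ((?f ^^ n) (s, B)) \<in> terminals G" for s B
  proof (induction s arbitrary: B rule: wf_induct_rule[OF wf])
    case (1 s)
    show ?case
    proof (cases "s \<in> terminals G")
      case True
      then show ?thesis by (intro exI[of _ 0]) simp
    next
      case False
      obtain s' B' where s': "?f (s, B) = (s', B')" by force
      have e: "(s, s') \<in> edges G" "B' \<in> bid_grid \<epsilon>"
        using play_step_edge[OF \<epsilon> \<gamma> _ "1.prems"(2), of s] False "1.prems" s' by auto
      moreover have "s' \<in> states G" using e G by (auto simp: edges_def game_structure_def)
      ultimately obtain n where "fst ((?f ^^ n) (s', B')) \<in> terminals G"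
        using "1.IH" by blast
      then have "fst ((?f ^^ Suc n) (s, B)) \<in> terminals G"
        by (simp add: funpow_swap1 s')
      then show ?thesis by blast
    qed
  qed
  have uniq: "fst ((?f ^^ m) p) = fst ((?f ^^ n) p)"
    if "fst ((?f ^^ m) p) \<in> terminals G" "m \<le> n" for m n p
  proof -
    have "(?f ^^ n) p = (?f ^^ (n - m)) ((?f ^^ m) p)"
      using that(2) by (metis comp_apply funpow_add le_add_diff_inverse2)
    then show ?thesis using that(1) play_step_terminal by (metis prod.collapse)
  qed
  have "init G \<in> states G" using G by (simp add: game_structure_def)
  then obtain n where n: "fst ((?f ^^ n) (init G, B)) \<in> terminals G"
    using ex[OF _ B] by auto
  show ?thesis
  proof (rule ex1I)
    show "fst ((?f ^^ n) (init G, B)) \<in> terminals G \<and>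
        (\<exists>m. fst ((?f ^^ m) (init G, B)) = fst ((?f ^^ n) (init G, B)))"
      using n by auto
  next
    fix t assume "t \<in> terminals G \<and> (\<exists>m. fst ((?f ^^ m) (init G, B)) = t)"
    then obtain m where m: "fst ((?f ^^ m) (init G, B)) = t" "t \<in> terminals G" by auto
    have "fst ((?f ^^ m) (init G, B)) = fst ((?f ^^ n) (init G, B))"
    proof (cases "m \<le> n")
      case True
      with m show ?thesis by (intro uniq) simp_all
    next
      case False
      then have "n \<le> m" by simp
      from uniq[OF n this] show ?thesis by (rule sym)
    qed
    with m(1) show "t = fst ((?f ^^ n) (init G, B))" by simp
  qed
qed

end

theory Submission
  imports Defs
begin

text \<open>Whatever the continuation payoffs are, a single bidding round is the reduced normal form of a
  Dutch auction: the price falls, and at each price first player 1 and then player 2 may stop the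
  clock and move.  This is a game of perfect information, so backward induction on the price (that
  is, adding the largest bid last) yields a pure equilibrium of the round; no monotonicity in the
  budget is needed.  Solving rounds state by state, from the terminals upwards, and applying the
  one-shot deviation principle extends any equilibrium on a successor-closed set of states to the
  whole game.\<close>

section \<open>A single bidding round\<close>

text \<open>Both pairs are actions, a bid with a next state, and \<open>B\<close> is the budget of
  player 1. The rule of a round is isolated from game and strategies so that it can be combined with
  arbitrary payoffs of the next position.\<close>

definition bid_result :: "real \<Rightarrow> real \<times> 'a \<Rightarrow> real \<times> 'a \<Rightarrow> 'a \<times> real" where
  "bid_result B x y =
     (if fst x \<ge> fst y then (snd x, B - fst x) else (snd y, B + fst y))"

lemma ex_maximizer:
  fixes f :: "'b \<Rightarrow> real"
  assumes "finite M" "M \<noteq> {}"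
  shows "\<exists>m\<in>M. \<forall>m'\<in>M. f m' \<le> f m"
  using assms arg_min_if_finite[of M "\<lambda>m. - f m"] by (meson neg_less_iff_less not_le)

text \<open>Induction on the total number of available bids, removing the largest bid
  \<open>c\<close> from a player who is certain to win with it, and starting from an equilibrium of
  the smaller round. Bidding \<open>c\<close> fixes the result whatever the opponent does, so its
  owner compares its value, at the best next state, with that of the old equilibrium. If
  \<open>c\<close> is not better, the old pair survives; if it is, \<open>c\<close> replaces the
  owner's action and the opponent cannot affect the result.\<close>

lemma bidding_round_equilibrium:
  fixes f1 f2 :: "'a \<times> real \<Rightarrow> real"
  assumes M: "finite M" "M \<noteq> {}"
  shows "\<lbrakk>finite A1; finite A2; 0 \<in> A1; 0 \<in> A2; \<forall>a\<in>A1 \<union> A2. 0 \<le> a\<rbrakk> \<Longrightarrow>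
    \<exists>x\<in>A1 \<times> M. \<exists>y\<in>A2 \<times> M.
      (\<forall>x'\<in>A1 \<times> M. f1 (bid_result B x' y) \<le> f1 (bid_result B x y)) \<and>
      (\<forall>y'\<in>A2 \<times> M. f2 (bid_result B x y') \<le> f2 (bid_result B x y))"
proof (induction "card A1 + card A2" arbitrary: A1 A2 rule: less_induct)
  case less
  note fin = less.prems(1,2)
  \<comment> \<open>The split mirrors the tie rule: player 2 is sure to win only with a bid strictly
    above \<open>Max A1\<close>, player 1 already with one equal to \<open>Max A2\<close>. In both
    inductive cases the removed bid is positive, so \<open>0\<close> stays available to
    both.\<close>
  consider (top2) "Max A2 > Max A1" | (top1) "Max A2 \<le> Max A1" "Max A1 > 0"
    | (base) "Max A2 \<le> Max A1" "Max A1 \<le> 0" by linarith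
  then show ?case
  proof cases
    case top2
    let ?c = "Max A2"
    have c: "?c \<in> A2" using fin less.prems(4) by (intro Max_in) auto
    have A1c: "\<forall>a\<in>A1. a < ?c" using fin top2 by (meson Max_ge order.strict_trans1)
    with less.prems(3) have "?c > 0" by blast
    have "card (A2 - {?c}) < card A2" using c fin by (intro card_Diff1_less)
    moreover have "0 \<in> A2 - {?c}" "\<forall>a\<in>A1 \<union> (A2 - {?c}). 0 \<le> a"
      using less.prems \<open>?c > 0\<close> by auto
    ultimately have "\<exists>x\<in>A1 \<times> M. \<exists>y\<in>(A2 - {?c}) \<times> M.
      (\<forall>x'\<in>A1 \<times> M. f1 (bid_result B x' y) \<le> f1 (bid_result B x y)) \<and>
      (\<forall>y'\<in>(A2 - {?c}) \<times> M. f2 (bid_result B x y') \<le> f2 (bid_result B x y))"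
      using fin less.prems(3) by (intro less.hyps) auto
    then obtain x y where x: "x \<in> A1 \<times> M" and y: "y \<in> (A2 - {?c}) \<times> M"
      and x_best: "\<forall>x'\<in>A1 \<times> M. f1 (bid_result B x' y) \<le> f1 (bid_result B x y)"
      and y_best: "\<forall>y'\<in>(A2 - {?c}) \<times> M. f2 (bid_result B x y') \<le> f2 (bid_result B x y)"
      by (elim bexE conjE, intro that)
    obtain m where m: "m \<in> M" "\<forall>m'\<in>M. f2 (m', B + ?c) \<le> f2 (m, B + ?c)"
      using ex_maximizer[OF M, of "\<lambda>m. f2 (m, B + ?c)"] by auto
    have win: "bid_result B x' (?c, m') = (m', B + ?c)" if "x' \<in> A1 \<times> M" for x' m'
      using that A1c by (auto simp: bid_result_def)
    show ?thesis
    proof (cases "f2 (m, B + ?c) > f2 (bid_result B x y)")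
      case True
      \<comment> \<open>Player 1 keeps \<open>x\<close>, although every action of hers now loses:
        against \<open>x\<close> the lower bids of player 2 yield at most the value of the smaller
        round, which \<open>?c\<close> exceeds.\<close>
      have "f2 (bid_result B x y') \<le> f2 (bid_result B x (?c, m))" if "y' \<in> A2 \<times> M" for y'
      proof (cases "fst y' = ?c")
        case True
        then have "bid_result B x y' = (snd y', B + ?c)"
          using win[OF x, of "snd y'"] by (metis prod.collapse)
        then show ?thesis using m(2) win[OF x, of m] that by auto
      next
        case False
        then have "y' \<in> (A2 - {?c}) \<times> M" using that by auto
        then have "f2 (bid_result B x y') \<le> f2 (bid_result B x y)" using y_best by blast
        then show ?thesis using True win[OF x, of m] \<open>f2 (m, B + ?c) > _\<close> by simp
      qed
      then show ?thesis using x c m win by (intro bexI[of _ x] bexI[of _ "(?c, m)"]) auto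
    next
      case False
      have "f2 (bid_result B x y') \<le> f2 (bid_result B x y)" if "y' \<in> A2 \<times> M" for y'
      proof (cases "fst y' = ?c")
        case True
        then have "bid_result B x y' = (snd y', B + ?c)"
          using win[OF x, of "snd y'"] by (metis prod.collapse)
        then show ?thesis using m(2) False that by force
      next
        case False
        then show ?thesis using y_best that by auto
      qed
      then show ?thesis using x y x_best by (intro bexI[of _ x] bexI[of _ y]) auto
    qed
  next
    case top1
    let ?c = "Max A1"
    have c: "?c \<in> A1" using fin less.prems(3) by (intro Max_in) auto
    \<comment> \<open>Equality is harmless, since player 1 wins ties; this is the only asymmetry to
      the previous case.\<close>
    have A2c: "\<forall>a\<in>A2. a \<le> ?c" using fin top1 by (meson Max_ge order.trans)
    have "card (A1 - {?c}) < card A1" using c fin by (intro card_Diff1_less)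
    moreover have "0 \<in> A1 - {?c}" "\<forall>a\<in>(A1 - {?c}) \<union> A2. 0 \<le> a"
      using less.prems top1 by auto
    ultimately have "\<exists>x\<in>(A1 - {?c}) \<times> M. \<exists>y\<in>A2 \<times> M.
      (\<forall>x'\<in>(A1 - {?c}) \<times> M. f1 (bid_result B x' y) \<le> f1 (bid_result B x y)) \<and>
      (\<forall>y'\<in>A2 \<times> M. f2 (bid_result B x y') \<le> f2 (bid_result B x y))"
      using fin less.prems(4) by (intro less.hyps) auto
    then obtain x y where x: "x \<in> (A1 - {?c}) \<times> M" and y: "y \<in> A2 \<times> M"
      and x_best: "\<forall>x'\<in>(A1 - {?c}) \<times> M. f1 (bid_result B x' y) \<le> f1 (bid_result B x y)"
      and y_best: "\<forall>y'\<in>A2 \<times> M. f2 (bid_result B x y') \<le> f2 (bid_result B x y)"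
      by (elim bexE conjE, intro that)
    obtain m where m: "m \<in> M" "\<forall>m'\<in>M. f1 (m', B - ?c) \<le> f1 (m, B - ?c)"
      using ex_maximizer[OF M, of "\<lambda>m. f1 (m, B - ?c)"] by auto
    have win: "bid_result B (?c, m') y' = (m', B - ?c)" if "y' \<in> A2 \<times> M" for y' m'
      using that A2c by (auto simp: bid_result_def)
    show ?thesis
    proof (cases "f1 (m, B - ?c) > f1 (bid_result B x y)")
      case True
      have "f1 (bid_result B x' y) \<le> f1 (bid_result B (?c, m) y)" if "x' \<in> A1 \<times> M" for x'
      proof (cases "fst x' = ?c")
        case True
        then have "bid_result B x' y = (snd x', B - ?c)"
          using win[OF y, of "snd x'"] by (metis prod.collapse)
        then show ?thesis using m(2) win[OF y, of m] that by auto
      next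
        case False
        then have "x' \<in> (A1 - {?c}) \<times> M" using that by auto
        then have "f1 (bid_result B x' y) \<le> f1 (bid_result B x y)" using x_best by blast
        then show ?thesis using True win[OF y, of m] \<open>f1 (m, B - ?c) > _\<close> by simp
      qed
      then show ?thesis using y c m win by (intro bexI[of _ "(?c, m)"] bexI[of _ y]) auto
    next
      case False
      have "f1 (bid_result B x' y) \<le> f1 (bid_result B x y)" if "x' \<in> A1 \<times> M" for x'
      proof (cases "fst x' = ?c")
        case True
        then have "bid_result B x' y = (snd x', B - ?c)"
          using win[OF y, of "snd x'"] by (metis prod.collapse)
        then show ?thesis using m(2) False that by force
      next
        case False
        then show ?thesis using x_best that by auto
      qed
      then show ?thesis using x y y_best by (intro bexI[of _ x] bexI[of _ y]) auto
    qed
  next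
    case base
    have "a = 0" if "a \<in> A1 \<union> A2" for a
      using that base less.prems(5) Max_ge[OF fin(1), of a] Max_ge[OF fin(2), of a]
      by (metis Un_iff order.antisym order.trans)
    then have A: "A1 = {0}" "A2 = {0}" using less.prems(3,4) by auto
    obtain m where "m \<in> M" "\<forall>m'\<in>M. f1 (m', B) \<le> f1 (m, B)"
      using ex_maximizer[OF M, of "\<lambda>m. f1 (m, B)"] by auto
    \<comment> \<open>Player 1 wins the tie at \<open>0\<close>, so only her next state counts; the
      second \<open>(0, m)\<close> is an arbitrary action of player 2.\<close>
    then show ?thesis
      by (intro bexI[of _ "(0, m)"] bexI[of _ "(0, m)"]) (auto simp: A bid_result_def)
  qed
qed

section \<open>Elementary facts about the grid of bids\<close>

lemma finite_bid_grid:
  assumes "\<epsilon> > 0"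
  shows "finite (bid_grid \<epsilon>)"
proof -
  have "bid_grid \<epsilon> \<subseteq> (\<lambda>k. real k * \<epsilon>) ` {..nat \<lfloor>1 / \<epsilon>\<rfloor>}"
    using assms by (auto simp: bid_grid_def le_nat_iff le_floor_iff field_simps intro!: imageI)
  then show ?thesis by (rule finite_subset) simp
qed

lemma zero_in_bid_grid: "0 \<in> bid_grid \<epsilon>"
  unfolding bid_grid_def by (intro CollectI exI[of _ 0]) simp

lemma bid_grid_bounds:
  assumes "\<epsilon> > 0" "B \<in> bid_grid \<epsilon>"
  shows "0 \<le> B" "B \<le> 1"
  using assms by (auto simp: bid_grid_def)

section \<open>Subgames\<close>

lemma states_subgame [simp]: "states (subgame G s) = (edges G)\<^sup>* `` {s}"
  and init_subgame [simp]: "init (subgame G s) = s"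
  and terminals_subgame [simp]: "terminals (subgame G s) = terminals G \<inter> (edges G)\<^sup>* `` {s}"
  and moves_subgame [simp]: "moves (subgame G s) = moves G"
  and util1_subgame [simp]: "util1 (subgame G s) = util1 G"
  and util2_subgame [simp]: "util2 (subgame G s) = util2 G"
  by (simp_all add: subgame_def)

lemma edges_subgame:
  assumes "game_structure G" "s \<in> states G"
  shows "edges (subgame G s) = {(x, y) \<in> edges G. (s, x) \<in> (edges G)\<^sup>*}"
  using reachable_in_states[OF assms] by (auto simp: edges_def[of "subgame G s"]) (auto simp: edges_def)

text \<open>The states of the subgame are closed under moves, so a path that starts inside never
  needs an edge that the subgame lacks.\<close>

lemma reachable_subgame:
  assumes "game_structure G" "s \<in> states G" "(s, s') \<in> (edges G)\<^sup>*"
  shows "(edges (subgame G s))\<^sup>* `` {s'} = (edges G)\<^sup>* `` {s'}"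
proof -
  have "(s', x) \<in> (edges (subgame G s))\<^sup>*" if "(s', x) \<in> (edges G)\<^sup>*" for x
    using that
  proof (induction rule: rtrancl_induct)
    case (step y z)
    then have "(y, z) \<in> edges (subgame G s)"
      using assms(3) by (auto simp: edges_subgame[OF assms(1,2)])
    with step.IH show ?case by (rule rtrancl_into_rtrancl)
  qed simp
  moreover have "(edges (subgame G s))\<^sup>* \<subseteq> (edges G)\<^sup>*"
    by (rule rtrancl_mono) (auto simp: edges_subgame[OF assms(1,2)])
  ultimately show ?thesis by auto
qed

text \<open>Forming a subgame resets the initial state and cuts states and terminals down to the
  reachable ones, but keeps \<open>moves\<close> and the utilities, so nesting produces the very
  same record. Equilibrium conditions in nested subgames can thus be rewritten as conditions in
  subgames of \<open>G\<close>.\<close>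

lemma subgame_subgame:
  assumes "game_structure G" "s \<in> states G" "(s, s') \<in> (edges G)\<^sup>*"
  shows "subgame (subgame G s) s' = subgame G s'"
proof -
  have "(edges G)\<^sup>* `` {s} \<inter> (edges G)\<^sup>* `` {s'} = (edges G)\<^sup>* `` {s'}"
    using assms(3) by auto
  then show ?thesis
    unfolding subgame_def[of _ s'] reachable_subgame[OF assms] terminals_subgame Int_assoc
    by (simp add: subgame_def)
qed

lemma positions_subgame_mono:
  assumes "(s, s') \<in> (edges G)\<^sup>*"
  shows "positions (subgame G s') \<epsilon> \<subseteq> positions (subgame G s) \<epsilon>"
  using assms by (auto simp: positions_def)

lemma positions_subgame_subset:
  assumes "game_structure G" "s \<in> states G"
  shows "positions (subgame G s) \<epsilon> \<subseteq> positions G \<epsilon>"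
  using reachable_in_states[OF assms] by (auto simp: positions_def)

lemma subgame_profile_subgame_profile:
  assumes "game_structure G" "s \<in> states G" "(s, s') \<in> (edges G)\<^sup>*"
  shows "subgame_profile (subgame G s) \<epsilon> (subgame_profile G \<epsilon> \<gamma> s) s' = subgame_profile G \<epsilon> \<gamma> s'"
  using positions_subgame_mono[OF assms(3), of \<epsilon>]
  by (auto simp: subgame_profile_def restrict_profile_def subgame_subgame[OF assms]
      restrict_restrict Int_absorb1)

text \<open>Equilibrium conditions in a subgame see a profile only through its restriction, so this
  carries them over to profiles altered elsewhere.\<close>

lemma subgame_profile_cong:
  assumes "\<And>p. p \<in> positions (subgame G s) \<epsilon> \<Longrightarrow> fst \<gamma> p = fst \<gamma>' p \<and> snd \<gamma> p = snd \<gamma>' p"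
  shows "subgame_profile G \<epsilon> \<gamma> s = subgame_profile G \<epsilon> \<gamma>' s"
  using assms by (auto simp: subgame_profile_def restrict_profile_def intro!: restrict_ext)

lemma subgame_profile_in_profiles:
  assumes "game_structure G" "s \<in> states G" "\<gamma> \<in> profiles G \<epsilon>"
  shows "subgame_profile G \<epsilon> \<gamma> s \<in> profiles (subgame G s) \<epsilon>"
proof -
  have "restrict f P \<in> Pi\<^sub>E P F" if "f \<in> Pi\<^sub>E Q F" "P \<subseteq> Q"
    for f :: "'a strategy" and F P Q
    using that by (auto simp: PiE_iff)
  note restr = this[OF _ positions_subgame_subset[OF assms(1,2)]]
  have "fst \<gamma> \<in> strategies1 G \<epsilon>" "snd \<gamma> \<in> strategies2 G \<epsilon>"
    using assms(3) by (simp_all add: profiles_def mem_Times_iff)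
  from restr[OF this(1)[unfolded strategies1_def]] restr[OF this(2)[unfolded strategies2_def]]
  have "restrict (fst \<gamma>) (positions (subgame G s) \<epsilon>) \<in> strategies1 (subgame G s) \<epsilon>"
    "restrict (snd \<gamma>) (positions (subgame G s) \<epsilon>) \<in> strategies2 (subgame G s) \<epsilon>"
    unfolding strategies1_def strategies2_def moves_subgame .
  then show ?thesis
    by (simp add: subgame_profile_def restrict_profile_def profiles_def)
qed

section \<open>Decomposing a play into its first round and the rest\<close>

lemma play_step_bid_result:
  assumes "s \<notin> terminals G"
  shows "play_step G \<gamma> (s, B) = bid_result B (fst \<gamma> (s, B)) (snd \<gamma> (s, B))"
  using assms by (cases \<gamma>) (auto simp: bid_result_def Let_def split: prod.split)

lemma outcome_terminal:
  assumes "init G \<in> terminals G"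
  shows "outcome G \<gamma> B = init G"
  using assms play_step_terminal[OF assms, where \<gamma> = \<gamma>]
  by (auto simp: outcome_def intro!: the_equality)

text \<open>After the first round the play stays among the states reachable from \<open>s'\<close>,
  where the restricted profile prescribes the same actions. Both plays then pass through the same
  positions, and uniqueness of the terminal reached identifies the outcomes.\<close>

lemma outcome_step:
  assumes G: "game_structure G" and \<epsilon>: "\<epsilon> > 0" and \<gamma>: "\<gamma> \<in> profiles G \<epsilon>"
    and B: "B \<in> bid_grid \<epsilon>" and nt: "init G \<notin> terminals G"
    and step: "play_step G \<gamma> (init G, B) = (s', B')"
  shows "outcome G \<gamma> B = outcome (subgame G s') (subgame_profile G \<epsilon> \<gamma> s') B'"
proof -
  let ?f = "play_step G \<gamma>"
  let ?H = "subgame G s'" and ?\<delta> = "subgame_profile G \<epsilon> \<gamma> s'"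
  have i: "init G \<in> states G - terminals G" using G nt by (auto simp: game_structure_def)
  have e: "(init G, s') \<in> edges G" "B' \<in> bid_grid \<epsilon>"
    using play_step_edge[OF \<epsilon> \<gamma> i B] step by auto
  then have s': "s' \<in> states G" using G by (auto simp: edges_def game_structure_def)
  have H: "game_structure ?H" and \<delta>: "?\<delta> \<in> profiles ?H \<epsilon>"
    using game_structure_subgame[OF G s'] subgame_profile_in_profiles[OF G s' \<gamma>] by auto
  \<comment> \<open>The last two conjuncts keep the current position inside the subgame and on the
    grid, where restriction does not change the actions at nonterminals.\<close>
  have same: "(play_step ?H ?\<delta> ^^ n) (s', B') = (?f ^^ n) (s', B') \<and>
      (s', fst ((?f ^^ n) (s', B'))) \<in> (edges G)\<^sup>* \<and> snd ((?f ^^ n) (s', B')) \<in> bid_grid \<epsilon>" for n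
  proof (induction n)
    case (Suc n)
    obtain x C where xC: "(?f ^^ n) (s', B') = (x, C)" by force
    with Suc have x: "(play_step ?H ?\<delta> ^^ n) (s', B') = (x, C)" "(s', x) \<in> (edges G)\<^sup>*"
      "C \<in> bid_grid \<epsilon>" by auto
    show ?case
    proof (cases "x \<in> terminals G")
      case True
      then show ?thesis using x xC by (cases \<gamma>; cases ?\<delta>) auto
    next
      case False
      have "x \<in> states G" using reachable_in_states[OF G s' x(2)] .
      with False play_step_edge[OF \<epsilon> \<gamma> _ x(3), of x]
      have "(x, fst (?f (x, C))) \<in> edges G" "snd (?f (x, C)) \<in> bid_grid \<epsilon>" by auto
      moreover have "(x, C) \<in> positions ?H \<epsilon>" using False x by (auto simp: positions_def)
      then have "play_step ?H ?\<delta> (x, C) = ?f (x, C)"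
        using False play_step_bid_result[of x ?H ?\<delta> C] play_step_bid_result[of x G \<gamma> C]
        by (simp add: subgame_profile_def restrict_profile_def)
      ultimately show ?thesis using x xC by (auto intro: rtrancl_into_rtrancl)
    qed
  qed (use e in auto)
  have "outcome G \<gamma> B \<in> terminals G \<and> (\<exists>n. fst ((?f ^^ n) (init G, B)) = outcome G \<gamma> B)"
    unfolding outcome_def by (rule theI'[OF outcome_well_defined[OF G \<epsilon> \<gamma> B]])
  then obtain n where t: "outcome G \<gamma> B \<in> terminals G" "fst ((?f ^^ n) (init G, B)) = outcome G \<gamma> B"
    by auto
  \<comment> \<open>The play of \<open>G\<close> is one round ahead of that of the subgame; it has a
    first round because it does not start at a terminal.\<close>
  with nt obtain m where "n = Suc m" by (cases n) auto
  with t(2) have "fst ((?f ^^ m) (s', B')) = outcome G \<gamma> B" by (simp add: funpow_swap1 step)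
  with same[of m] t(1)
  have "outcome G \<gamma> B \<in> terminals ?H \<and> (\<exists>n. fst ((play_step ?H ?\<delta> ^^ n) (init ?H, B')) = outcome G \<gamma> B)"
    by (auto intro!: exI[of _ m])
  from the1_equality[OF outcome_well_defined[OF H \<epsilon> \<delta> e(2)] this] show ?thesis
    by (simp add: outcome_def[of ?H])
qed

section \<open>Extending equilibria\<close>

text \<open>Composed with \<open>util1 G\<close> and \<open>util2 G\<close>, this supplies the
  payoff functions \<open>f1\<close> and \<open>f2\<close> of
  \<open>bidding_round_equilibrium\<close>.\<close>

definition continuation :: "'a game \<Rightarrow> real \<Rightarrow> 'a profile \<Rightarrow> 'a \<times> real \<Rightarrow> 'a" where
  "continuation G \<epsilon> \<gamma> p = outcome (subgame G (fst p)) (subgame_profile G \<epsilon> \<gamma> (fst p)) (snd p)"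

text \<open>The condition in \<open>PSPE\<close> is localised so that it can be established one
  state at a time and preserved on a set of states.\<close>

definition equilibrium_at :: "'a game \<Rightarrow> real \<Rightarrow> 'a profile \<Rightarrow> 'a \<Rightarrow> bool" where
  "equilibrium_at G \<epsilon> \<gamma> s \<longleftrightarrow>
     (\<forall>B\<in>bid_grid \<epsilon>. equilibrium (subgame G s) \<epsilon> B (subgame_profile G \<epsilon> \<gamma> s))"

lemma PSPE_iff:
  "PSPE G \<epsilon> \<gamma> \<longleftrightarrow> \<gamma> \<in> profiles G \<epsilon> \<and> (\<forall>s\<in>states G. equilibrium_at G \<epsilon> \<gamma> s)"
  by (simp add: PSPE_def equilibrium_at_def)

lemma equilibrium_at_terminal:
  assumes "s \<in> terminals G"
  shows "equilibrium_at G \<epsilon> \<gamma> s"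
  using assms by (simp add: equilibrium_at_def equilibrium_def outcome_terminal)

text \<open>One-shot deviation: by the equilibria at the successors, a deviating player does not lose by
  returning to the old strategy after the first round.\<close>

lemma equilibrium_step:
  assumes G: "game_structure G" and \<epsilon>: "\<epsilon> > 0" and \<gamma>: "\<gamma> \<in> profiles G \<epsilon>"
    and s: "s \<in> states G - terminals G" and B: "B \<in> bid_grid \<epsilon>"
    and succ: "\<forall>s'\<in>moves G s. equilibrium_at G \<epsilon> \<gamma> s'"
    and best1: "\<forall>x\<in>{b \<in> bid_grid \<epsilon>. b \<le> B} \<times> moves G s.
      util1 G (continuation G \<epsilon> \<gamma> (bid_result B x (snd \<gamma> (s, B)))) \<le>
      util1 G (continuation G \<epsilon> \<gamma> (bid_result B (fst \<gamma> (s, B)) (snd \<gamma> (s, B))))"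
    and best2: "\<forall>y\<in>{b \<in> bid_grid \<epsilon>. b \<le> 1 - B} \<times> moves G s.
      util2 G (continuation G \<epsilon> \<gamma> (bid_result B (fst \<gamma> (s, B)) y)) \<le>
      util2 G (continuation G \<epsilon> \<gamma> (bid_result B (fst \<gamma> (s, B)) (snd \<gamma> (s, B))))"
  shows "equilibrium (subgame G s) \<epsilon> B (subgame_profile G \<epsilon> \<gamma> s)"
proof -
  let ?H = "subgame G s" and ?\<delta> = "subgame_profile G \<epsilon> \<gamma> s"
  have sG: "s \<in> states G" and nt: "init ?H \<notin> terminals ?H" using s by auto
  have H: "game_structure ?H" and \<delta>: "?\<delta> \<in> profiles ?H \<epsilon>"
    using game_structure_subgame[OF G sG] subgame_profile_in_profiles[OF G sG \<gamma>] by auto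
  have p: "(s, B) \<in> positions ?H \<epsilon>" using s B by (auto simp: positions_def)
  have \<delta>_s: "fst ?\<delta> (s, B) = fst \<gamma> (s, B)" "snd ?\<delta> (s, B) = snd \<gamma> (s, B)"
    using p by (auto simp: subgame_profile_def restrict_profile_def)
  have reach: "(s, s') \<in> (edges G)\<^sup>*" if "s' \<in> moves G s" for s'
    using that s by (auto simp: edges_def)
  \<comment> \<open>Stated for every profile of the subgame because it is used three times: for
    \<open>?\<delta>\<close> and for a deviation of either player.\<close>
  have first: "\<exists>s' B'. bid_result B (fst \<tau> (s, B)) (snd \<tau> (s, B)) = (s', B') \<and>
      s' \<in> moves G s \<and> B' \<in> bid_grid \<epsilon> \<and>
      outcome ?H \<tau> B = outcome (subgame G s') (subgame_profile ?H \<epsilon> \<tau> s') B'"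
    if "\<tau> \<in> profiles ?H \<epsilon>" for \<tau>
  proof -
    obtain s' B' where st: "play_step ?H \<tau> (s, B) = (s', B')" by force
    have "(s, s') \<in> edges ?H" "B' \<in> bid_grid \<epsilon>"
      using play_step_edge[OF \<epsilon> that _ B, of s] s st by auto
    then have s': "s' \<in> moves G s" "B' \<in> bid_grid \<epsilon>" by (auto simp: edges_def)
    have "outcome ?H \<tau> B = outcome (subgame G s') (subgame_profile ?H \<epsilon> \<tau> s') B'"
      using outcome_step[OF H \<epsilon> that B nt] st subgame_subgame[OF G sG reach[OF s'(1)]] by simp
    then show ?thesis using st s' s by (auto simp: play_step_bid_result)
  qed
  have val: "outcome ?H ?\<delta> B =
      continuation G \<epsilon> \<gamma> (bid_result B (fst \<gamma> (s, B)) (snd \<gamma> (s, B)))"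
    using first[OF \<delta>]
    by (auto simp: \<delta>_s continuation_def subgame_profile_subgame_profile[OF G sG reach])
  have "util1 G (outcome ?H (\<tau>, snd ?\<delta>) B) \<le> util1 G (outcome ?H ?\<delta> B)"
    if \<tau>: "\<tau> \<in> strategies1 ?H \<epsilon>" for \<tau>
  proof -
    have dev: "(\<tau>, snd ?\<delta>) \<in> profiles ?H \<epsilon>" using \<tau> \<delta> by (auto simp: profiles_def)
    obtain s' B' where st: "bid_result B (\<tau> (s, B)) (snd \<gamma> (s, B)) = (s', B')"
      and s': "s' \<in> moves G s" "B' \<in> bid_grid \<epsilon>"
      and out: "outcome ?H (\<tau>, snd ?\<delta>) B =
        outcome (subgame G s') (subgame_profile ?H \<epsilon> (\<tau>, snd ?\<delta>) s') B'"
      using first[OF dev] \<delta>_s by auto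
    let ?\<tau>' = "subgame_profile ?H \<epsilon> (\<tau>, snd ?\<delta>) s'"
    have "?\<tau>' \<in> profiles (subgame ?H s') \<epsilon>"
      using reach[OF s'(1)] by (intro subgame_profile_in_profiles[OF H _ dev]) simp
    then have "fst ?\<tau>' \<in> strategies1 (subgame G s') \<epsilon>"
      using subgame_subgame[OF G sG reach[OF s'(1)]] by (auto simp: profiles_def)
    \<comment> \<open>Only player 1 deviates, so player 2 still follows \<open>\<gamma>\<close>
      after the first round, and the equilibrium at \<open>s'\<close> bounds the rest of the
      deviation. The first round is then bounded by \<open>best1\<close>.\<close>
    moreover have "snd ?\<tau>' = snd (subgame_profile G \<epsilon> \<gamma> s')"
      using subgame_profile_subgame_profile[OF G sG reach[OF s'(1)], of \<epsilon> \<gamma>]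
      by (metis subgame_profile_def restrict_profile_def snd_conv)
    ultimately have "util1 G (outcome ?H (\<tau>, snd ?\<delta>) B) \<le> util1 G (continuation G \<epsilon> \<gamma> (s', B'))"
      using succ s' out unfolding equilibrium_at_def equilibrium_def continuation_def
      by (metis fst_conv prod.collapse snd_conv util1_subgame)
    moreover have "\<tau> (s, B) \<in> {b \<in> bid_grid \<epsilon>. b \<le> B} \<times> moves G s"
      using PiE_mem[OF \<tau>[unfolded strategies1_def] p] by simp
    ultimately show ?thesis using best1 st val by fastforce
  qed
  moreover have "util2 G (outcome ?H (fst ?\<delta>, \<tau>) B) \<le> util2 G (outcome ?H ?\<delta> B)"
    if \<tau>: "\<tau> \<in> strategies2 ?H \<epsilon>" for \<tau>
  proof -
    have dev: "(fst ?\<delta>, \<tau>) \<in> profiles ?H \<epsilon>" using \<tau> \<delta> by (auto simp: profiles_def)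
    obtain s' B' where st: "bid_result B (fst \<gamma> (s, B)) (\<tau> (s, B)) = (s', B')"
      and s': "s' \<in> moves G s" "B' \<in> bid_grid \<epsilon>"
      and out: "outcome ?H (fst ?\<delta>, \<tau>) B =
        outcome (subgame G s') (subgame_profile ?H \<epsilon> (fst ?\<delta>, \<tau>) s') B'"
      using first[OF dev] \<delta>_s by auto
    let ?\<tau>' = "subgame_profile ?H \<epsilon> (fst ?\<delta>, \<tau>) s'"
    have "?\<tau>' \<in> profiles (subgame ?H s') \<epsilon>"
      using reach[OF s'(1)] by (intro subgame_profile_in_profiles[OF H _ dev]) simp
    then have "snd ?\<tau>' \<in> strategies2 (subgame G s') \<epsilon>"
      using subgame_subgame[OF G sG reach[OF s'(1)]] by (auto simp: profiles_def)
    moreover have "fst ?\<tau>' = fst (subgame_profile G \<epsilon> \<gamma> s')"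
      using subgame_profile_subgame_profile[OF G sG reach[OF s'(1)], of \<epsilon> \<gamma>]
      by (metis subgame_profile_def restrict_profile_def fst_conv)
    ultimately have "util2 G (outcome ?H (fst ?\<delta>, \<tau>) B) \<le> util2 G (continuation G \<epsilon> \<gamma> (s', B'))"
      using succ s' out unfolding equilibrium_at_def equilibrium_def continuation_def
      by (metis fst_conv prod.collapse snd_conv util2_subgame)
    moreover have "\<tau> (s, B) \<in> {b \<in> bid_grid \<epsilon>. b \<le> 1 - B} \<times> moves G s"
      using PiE_mem[OF \<tau>[unfolded strategies2_def] p] by simp
    ultimately show ?thesis using best2 st val by fastforce
  qed
  ultimately show ?thesis by (simp add: equilibrium_def)
qed

text \<open>By acyclicity a play that leaves \<open>s\<close> never returns. Continuations computed
  from \<open>\<gamma>\<close> therefore stay correct when \<open>\<gamma>\<close> is changed at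
  \<open>s\<close>, and equilibria of the rounds at \<open>s\<close> can be inserted for all budgets
  at once.\<close>

lemma extend_equilibrium_state:
  assumes G: "game_structure G" and \<epsilon>: "\<epsilon> > 0" and \<gamma>: "\<gamma> \<in> profiles G \<epsilon>"
    and s: "s \<in> states G - terminals G"
    and succ: "\<forall>s'\<in>moves G s. equilibrium_at G \<epsilon> \<gamma> s'"
  shows "\<exists>\<gamma>'\<in>profiles G \<epsilon>. (\<forall>p. fst p \<noteq> s \<longrightarrow> fst \<gamma>' p = fst \<gamma> p \<and> snd \<gamma>' p = snd \<gamma> p) \<and>
    equilibrium_at G \<epsilon> \<gamma>' s"
proof -
  let ?A1 = "\<lambda>B. {b \<in> bid_grid \<epsilon>. b \<le> B}" and ?A2 = "\<lambda>B. {b \<in> bid_grid \<epsilon>. b \<le> 1 - B}"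
  let ?M = "moves G s"
  let ?f1 = "\<lambda>p. util1 G (continuation G \<epsilon> \<gamma> p)" and ?f2 = "\<lambda>p. util2 G (continuation G \<epsilon> \<gamma> p)"
  have M: "finite ?M" "?M \<noteq> {}" "?M \<subseteq> states G"
    using G s unfolding game_structure_def by (auto intro: finite_subset)
  have "\<forall>B\<in>bid_grid \<epsilon>. \<exists>xy. fst xy \<in> ?A1 B \<times> ?M \<and> snd xy \<in> ?A2 B \<times> ?M \<and>
      (\<forall>x\<in>?A1 B \<times> ?M. ?f1 (bid_result B x (snd xy)) \<le> ?f1 (bid_result B (fst xy) (snd xy))) \<and>
      (\<forall>y\<in>?A2 B \<times> ?M. ?f2 (bid_result B (fst xy) y) \<le> ?f2 (bid_result B (fst xy) (snd xy)))"
    (is "\<forall>B\<in>_. \<exists>xy. ?P B xy")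
  proof
    fix B assume B: "B \<in> bid_grid \<epsilon>"
    have "finite (?A1 B)" "finite (?A2 B)" "0 \<in> ?A1 B" "0 \<in> ?A2 B" "\<forall>a\<in>?A1 B \<union> ?A2 B. 0 \<le> a"
      using finite_bid_grid[OF \<epsilon>] zero_in_bid_grid[of \<epsilon>] bid_grid_bounds[OF \<epsilon>] B by auto
    from bidding_round_equilibrium[OF M(1,2) this, of ?f1 B ?f2]
    obtain x y where "x \<in> ?A1 B \<times> ?M" "y \<in> ?A2 B \<times> ?M"
      "\<forall>x'\<in>?A1 B \<times> ?M. ?f1 (bid_result B x' y) \<le> ?f1 (bid_result B x y)"
      "\<forall>y'\<in>?A2 B \<times> ?M. ?f2 (bid_result B x y') \<le> ?f2 (bid_result B x y)"
      by (elim bexE conjE, intro that)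
    then show "\<exists>xy. ?P B xy" by (intro exI[of _ "(x, y)"]) simp
  qed
  then obtain c where "\<forall>B\<in>bid_grid \<epsilon>. ?P B (c B)" by (rule bchoice[THEN exE])
  note c = bspec[OF this]
  \<comment> \<open>Off the grid the value of \<open>\<gamma>\<close> is kept; it is
    \<open>undefined\<close> there, as extensionality demands.\<close>
  define \<gamma>' where "\<gamma>' =
    ((\<lambda>p. if fst p = s \<and> snd p \<in> bid_grid \<epsilon> then fst (c (snd p)) else fst \<gamma> p),
     (\<lambda>p. if fst p = s \<and> snd p \<in> bid_grid \<epsilon> then snd (c (snd p)) else snd \<gamma> p))"
  have "fst \<gamma>' \<in> strategies1 G \<epsilon>"
    using \<gamma> c s unfolding strategies1_def profiles_def \<gamma>'_def positions_def
    by (force simp: PiE_iff extensional_def)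
  moreover have "snd \<gamma>' \<in> strategies2 G \<epsilon>"
    using \<gamma> c s unfolding strategies2_def profiles_def \<gamma>'_def positions_def
    by (force simp: PiE_iff extensional_def)
  ultimately have \<gamma>': "\<gamma>' \<in> profiles G \<epsilon>"
    by (metis mem_Times_iff profiles_def)
  have at_s: "fst \<gamma>' (s, B) = fst (c B)" "snd \<gamma>' (s, B) = snd (c B)" if "B \<in> bid_grid \<epsilon>" for B
    using that by (auto simp: \<gamma>'_def)
  have off_s: "fst \<gamma>' p = fst \<gamma> p \<and> snd \<gamma>' p = snd \<gamma> p" if "fst p \<noteq> s" for p
    using that by (auto simp: \<gamma>'_def)
  have same: "subgame_profile G \<epsilon> \<gamma>' s' = subgame_profile G \<epsilon> \<gamma> s'" if "s' \<in> ?M" for s'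
  proof (rule subgame_profile_cong)
    fix p assume "p \<in> positions (subgame G s') \<epsilon>"
    then have "(s', fst p) \<in> (edges G)\<^sup>*" by (auto simp: positions_def)
    moreover have "(s, s') \<in> edges G" using that s by (auto simp: edges_def)
    ultimately have "(s, fst p) \<in> (edges G)\<^sup>+" by (rule rtrancl_into_trancl2[rotated])
    then have "fst p \<noteq> s" using G by (auto simp: game_structure_def acyclic_def)
    then show "fst \<gamma>' p = fst \<gamma> p \<and> snd \<gamma>' p = snd \<gamma> p" by (rule off_s)
  qed
  \<comment> \<open>Both next states must be moves at \<open>s\<close>, since either player may win
    the round.\<close>
  have cont: "continuation G \<epsilon> \<gamma>' (bid_result B x y) = continuation G \<epsilon> \<gamma> (bid_result B x y)"
    if "snd x \<in> ?M" "snd y \<in> ?M" for B x y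
    using that same by (auto simp: continuation_def bid_result_def)
  have "equilibrium (subgame G s) \<epsilon> B (subgame_profile G \<epsilon> \<gamma>' s)" if B: "B \<in> bid_grid \<epsilon>" for B
  proof (rule equilibrium_step[OF G \<epsilon> \<gamma>' s B])
    show "\<forall>s'\<in>?M. equilibrium_at G \<epsilon> \<gamma>' s'"
      using succ same by (simp add: equilibrium_at_def)
    have cM: "snd (fst (c B)) \<in> ?M" "snd (snd (c B)) \<in> ?M"
      using c[OF B] by (auto simp: mem_Times_iff)
    show "\<forall>x\<in>?A1 B \<times> ?M. util1 G (continuation G \<epsilon> \<gamma>' (bid_result B x (snd \<gamma>' (s, B)))) \<le>
        util1 G (continuation G \<epsilon> \<gamma>' (bid_result B (fst \<gamma>' (s, B)) (snd \<gamma>' (s, B))))"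
      using c[OF B] cM by (simp add: at_s[OF B] cont mem_Times_iff)
    show "\<forall>y\<in>?A2 B \<times> ?M. util2 G (continuation G \<epsilon> \<gamma>' (bid_result B (fst \<gamma>' (s, B)) y)) \<le>
        util2 G (continuation G \<epsilon> \<gamma>' (bid_result B (fst \<gamma>' (s, B)) (snd \<gamma>' (s, B))))"
      using c[OF B] cM by (simp add: at_s[OF B] cont mem_Times_iff)
  qed
  then have "equilibrium_at G \<epsilon> \<gamma>' s" by (simp add: equilibrium_at_def)
  with \<gamma>' off_s show ?thesis by blast
qed

text \<open>\<open>D\<close> is the part already solved. It grows by a state whose successors all
  lie in \<open>D\<close>; closure under edges ensures that the subgames solved before never meet
  the new state. The empty \<open>D\<close> gives existence, and the states reachable from the moves
  at the root give the extension of prescribed equilibria.\<close>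

lemma extend_equilibrium:
  assumes G: "game_structure G" and \<epsilon>: "\<epsilon> > 0"
  shows "\<lbrakk>\<gamma> \<in> profiles G \<epsilon>; edges G `` D \<subseteq> D; \<forall>s\<in>D \<inter> states G. equilibrium_at G \<epsilon> \<gamma> s\<rbrakk> \<Longrightarrow>
    \<exists>\<gamma>'. PSPE G \<epsilon> \<gamma>' \<and> (\<forall>p. fst p \<in> D \<longrightarrow> fst \<gamma>' p = fst \<gamma> p \<and> snd \<gamma>' p = snd \<gamma> p)"
proof (induction "card (states G - D)" arbitrary: \<gamma> D rule: less_induct)
  case less
  have fin: "finite (states G)" using G by (simp add: game_structure_def)
  show ?case
  proof (cases "states G \<subseteq> D")
    case True
    then have "PSPE G \<epsilon> \<gamma>" using less.prems by (auto simp: PSPE_iff)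
    then show ?thesis by blast
  next
    case False
    have "edges G \<subseteq> states G \<times> states G"
      using G by (auto simp: edges_def game_structure_def)
    then have "wf ((edges G)\<inverse>)"
      using G fin unfolding game_structure_def
      by (meson finite_SigmaI finite_subset finite_acyclic_wf_converse)
    \<comment> \<open>A minimal unsolved state for the converse of the edges has only solved
      successors.\<close>
    then obtain s where s: "s \<in> states G - D"
      and "\<And>y. (y, s) \<in> (edges G)\<inverse> \<Longrightarrow> y \<notin> states G - D"
      using False wfE_min[of _ _ "states G - D"] by (metis Diff_eq_empty_iff all_not_in_conv)
    then have succ: "y \<in> D \<inter> states G" if "(s, y) \<in> edges G" for y
      using that \<open>edges G \<subseteq> _\<close> by auto
    obtain \<gamma>' where \<gamma>': "\<gamma>' \<in> profiles G \<epsilon>" "equilibrium_at G \<epsilon> \<gamma>' s"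
      and off: "\<And>p. fst p \<noteq> s \<Longrightarrow> fst \<gamma>' p = fst \<gamma> p \<and> snd \<gamma>' p = snd \<gamma> p"
    proof (cases "s \<in> terminals G")
      case True
      then show ?thesis using that less.prems(1) equilibrium_at_terminal by metis
    next
      case False
      then have "\<forall>s'\<in>moves G s. equilibrium_at G \<epsilon> \<gamma> s'"
        using s less.prems(3) succ by (auto simp: edges_def)
      then show ?thesis
        using extend_equilibrium_state[OF G \<epsilon> less.prems(1), of s] that s False by blast
    qed
    have "equilibrium_at G \<epsilon> \<gamma>' x" if x: "x \<in> D \<inter> states G" for x
    proof -
      \<comment> \<open>Subgames rooted in \<open>D\<close> stay in \<open>D\<close>, and
        \<open>s\<close> lies outside it, so they do not notice the change at
        \<open>s\<close>.\<close>
      have "(edges G)\<^sup>* `` D \<subseteq> D" using less.prems(2) by (simp add: Image_closed_trancl)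
      then have "subgame_profile G \<epsilon> \<gamma>' x = subgame_profile G \<epsilon> \<gamma> x"
        using x s by (intro subgame_profile_cong off) (auto simp: positions_def)
      then show ?thesis using less.prems(3) x by (auto simp: equilibrium_at_def)
    qed
    then have eq: "\<forall>x\<in>insert s D \<inter> states G. equilibrium_at G \<epsilon> \<gamma>' x" using \<gamma>'(2) by auto
    have closed: "edges G `` insert s D \<subseteq> insert s D"
      using less.prems(2) succ by auto
    have "states G - insert s D \<subset> states G - D" using s by auto
    then have "card (states G - insert s D) < card (states G - D)"
      using fin by (intro psubset_card_mono) auto
    from less.hyps[OF this \<gamma>'(1) closed eq] off s show ?thesis by (metis DiffE insertCI)
  qed
qed

section \<open>Existence, and gluing of equilibria of the subgames\<close>

lemma profiles_nonempty:
  assumes G: "game_structure G" and \<epsilon>: "\<epsilon> > 0"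
  shows "profiles G \<epsilon> \<noteq> {}"
proof -
  have "strategies1 G \<epsilon> \<noteq> {}" "strategies2 G \<epsilon> \<noteq> {}"
    using G bid_grid_bounds[OF \<epsilon>] zero_in_bid_grid[of \<epsilon>]
    unfolding strategies1_def strategies2_def PiE_eq_empty_iff game_structure_def positions_def
    by force+
  then show ?thesis by (auto simp: profiles_def)
qed

text \<open>Subgames at different successors may share states, and a common extension can exist only
  if the given profiles agree there; hence the compatibility premise. The root is assumed
  nonterminal because \<open>moves\<close> is unspecified at terminals.\<close>

theorem theorem2:
  fixes G :: "'a game" and \<epsilon> :: real and R :: nat
  assumes "game_structure G"
    and "R > 0" and "\<epsilon> = 1 / real R"
  shows "(\<exists>\<gamma>. PSPE G \<epsilon> \<gamma>) \<and>
    (\<forall>\<gamma>s :: 'a \<Rightarrow> 'a profile.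
       init G \<notin> terminals G \<longrightarrow>
       (\<forall>s \<in> moves G (init G). PSPE (subgame G s) \<epsilon> (\<gamma>s s)) \<longrightarrow>
       (\<forall>s \<in> moves G (init G). \<forall>s' \<in> moves G (init G).
          let P = positions (subgame G s) \<epsilon> \<inter> positions (subgame G s') \<epsilon>
          in restrict_profile P (\<gamma>s s) = restrict_profile P (\<gamma>s s')) \<longrightarrow>
       (\<exists>\<gamma>'. PSPE G \<epsilon> \<gamma>' \<and> (\<forall>s \<in> moves G (init G). subgame_profile G \<epsilon> \<gamma>' s = \<gamma>s s)))"
proof (intro conjI allI impI)
  note G = assms(1)
  have \<epsilon>: "\<epsilon> > 0" using assms by simp
  obtain \<gamma>0 where \<gamma>0: "\<gamma>0 \<in> profiles G \<epsilon>" using profiles_nonempty[OF G \<epsilon>] by auto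
  then have \<gamma>0_strategies: "fst \<gamma>0 \<in> strategies1 G \<epsilon>" "snd \<gamma>0 \<in> strategies2 G \<epsilon>"
    by (simp_all add: profiles_def mem_Times_iff)
  \<comment> \<open>The empty set is closed and trivially solved, so any profile can serve as the
    start.\<close>
  show "\<exists>\<gamma>. PSPE G \<epsilon> \<gamma>"
    using extend_equilibrium[OF G \<epsilon> \<gamma>0, of "{}"] by auto
  fix \<gamma>s :: "'a \<Rightarrow> 'a profile"
  let ?M = "moves G (init G)"
  assume nt: "init G \<notin> terminals G"
    and sub: "\<forall>s\<in>?M. PSPE (subgame G s) \<epsilon> (\<gamma>s s)"
    and compat: "\<forall>s\<in>?M. \<forall>s'\<in>?M.
          let P = positions (subgame G s) \<epsilon> \<inter> positions (subgame G s') \<epsilon>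
          in restrict_profile P (\<gamma>s s) = restrict_profile P (\<gamma>s s')"
  have M: "?M \<subseteq> states G" using G nt by (auto simp: game_structure_def)
  define D where "D = (edges G)\<^sup>* `` ?M"
  \<comment> \<open>A state of \<open>D\<close> may be reachable from several successors of the
    root; \<open>j\<close> fixes one of them. By compatibility the choice does not matter, which is
    \<open>agree\<close> below.\<close>
  define j where "j x = (SOME s. s \<in> ?M \<and> (s, x) \<in> (edges G)\<^sup>*)" for x
  have j: "j x \<in> ?M \<and> (j x, x) \<in> (edges G)\<^sup>*" if "x \<in> D" for x
    unfolding j_def by (rule someI_ex) (use that in \<open>auto simp: D_def\<close>)
  \<comment> \<open>Outside \<open>D\<close> the profile \<open>\<gamma>0\<close> is only a filler,
    which \<open>extend_equilibrium\<close> may overwrite.\<close>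
  define \<gamma> where "\<gamma> =
    ((\<lambda>p. if fst p \<in> D then fst (\<gamma>s (j (fst p))) p else fst \<gamma>0 p),
     (\<lambda>p. if fst p \<in> D then snd (\<gamma>s (j (fst p))) p else snd \<gamma>0 p))"
  have agree: "fst \<gamma> p = fst (\<gamma>s s) p \<and> snd \<gamma> p = snd (\<gamma>s s) p"
    if s: "s \<in> ?M" and p: "p \<in> positions (subgame G s) \<epsilon>" for s p
  proof -
    have D: "fst p \<in> D" using s p by (auto simp: D_def positions_def)
    have p': "p \<in> positions (subgame G (j (fst p))) \<epsilon>"
      using p j[OF D] by (auto simp: positions_def)
    then show ?thesis
      using compat[rule_format, OF s conjunct1[OF j[OF D]]] p D
      by (auto simp: Let_def restrict_profile_def \<gamma>_def restrict_def fun_eq_iff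
          dest!: spec[of _ "fst p"] spec[of _ "snd p"])
  qed
  have \<gamma>s: "\<gamma>s s \<in> profiles (subgame G s) \<epsilon>" if "s \<in> ?M" for s
    using sub that by (auto simp: PSPE_def)
  have sub_\<gamma>: "subgame_profile G \<epsilon> \<gamma> s = \<gamma>s s" if s: "s \<in> ?M" for s
  proof -
    \<comment> \<open>Extensionality turns agreement on the positions of the subgame into equality
      of functions.\<close>
    have "restrict (fst \<gamma>) (positions (subgame G s) \<epsilon>) = fst (\<gamma>s s)"
      using \<gamma>s[OF s] agree[OF s]
      by (auto simp: profiles_def strategies1_def PiE_iff extensional_def)
    moreover have "restrict (snd \<gamma>) (positions (subgame G s) \<epsilon>) = snd (\<gamma>s s)"
      using \<gamma>s[OF s] agree[OF s]
      by (auto simp: profiles_def strategies2_def PiE_iff extensional_def)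
    ultimately show ?thesis by (simp add: subgame_profile_def restrict_profile_def)
  qed
  have in_sub: "p \<in> positions (subgame G (j (fst p))) \<epsilon>"
    if "p \<in> positions G \<epsilon>" "fst p \<in> D" for p
    using that j by (auto simp: positions_def)
  have "fst \<gamma> \<in> strategies1 G \<epsilon>"
    unfolding strategies1_def
  proof (rule PiE_I)
    fix p assume p: "p \<in> positions G \<epsilon>"
    show "fst \<gamma> p \<in> (case p of (s, B) \<Rightarrow> {b \<in> bid_grid \<epsilon>. b \<le> B} \<times> moves G s)"
    proof (cases "fst p \<in> D")
      case True
      then have "fst (\<gamma>s (j (fst p))) \<in> strategies1 (subgame G (j (fst p))) \<epsilon>"
        using \<gamma>s j by (simp add: profiles_def mem_Times_iff)
      from PiE_mem[OF this[unfolded strategies1_def] in_sub[OF p True]] True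
      show ?thesis by (simp add: \<gamma>_def)
    next
      case False
      with PiE_mem[OF \<gamma>0_strategies(1)[unfolded strategies1_def] p] show ?thesis
        by (simp add: \<gamma>_def)
    qed
  next
    fix p assume p: "p \<notin> positions G \<epsilon>"
    show "fst \<gamma> p = undefined"
    proof (cases "fst p \<in> D")
      case True
      \<comment> \<open>A position of the subgame would be one of \<open>G\<close>, so the given
        strategy is \<open>undefined\<close> at \<open>p\<close> as well.\<close>
      with j M have out: "p \<notin> positions (subgame G (j (fst p))) \<epsilon>"
        using positions_subgame_subset[OF G] p by blast
      have "fst (\<gamma>s (j (fst p))) \<in> strategies1 (subgame G (j (fst p))) \<epsilon>"
        using \<gamma>s j[OF True] by (simp add: profiles_def mem_Times_iff)
      from PiE_arb[OF this[unfolded strategies1_def] out] True show ?thesis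
        by (simp add: \<gamma>_def)
    next
      case False
      with PiE_arb[OF \<gamma>0_strategies(1)[unfolded strategies1_def] p] show ?thesis
        by (simp add: \<gamma>_def)
    qed
  qed
  moreover have "snd \<gamma> \<in> strategies2 G \<epsilon>"
    unfolding strategies2_def
  proof (rule PiE_I)
    fix p assume p: "p \<in> positions G \<epsilon>"
    show "snd \<gamma> p \<in> (case p of (s, B) \<Rightarrow> {b \<in> bid_grid \<epsilon>. b \<le> 1 - B} \<times> moves G s)"
    proof (cases "fst p \<in> D")
      case True
      then have "snd (\<gamma>s (j (fst p))) \<in> strategies2 (subgame G (j (fst p))) \<epsilon>"
        using \<gamma>s j by (simp add: profiles_def mem_Times_iff)
      from PiE_mem[OF this[unfolded strategies2_def] in_sub[OF p True]] True
      show ?thesis by (simp add: \<gamma>_def)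
    next
      case False
      with PiE_mem[OF \<gamma>0_strategies(2)[unfolded strategies2_def] p] show ?thesis
        by (simp add: \<gamma>_def)
    qed
  next
    fix p assume p: "p \<notin> positions G \<epsilon>"
    show "snd \<gamma> p = undefined"
    proof (cases "fst p \<in> D")
      case True
      with j M have out: "p \<notin> positions (subgame G (j (fst p))) \<epsilon>"
        using positions_subgame_subset[OF G] p by blast
      have "snd (\<gamma>s (j (fst p))) \<in> strategies2 (subgame G (j (fst p))) \<epsilon>"
        using \<gamma>s j[OF True] by (simp add: profiles_def mem_Times_iff)
      from PiE_arb[OF this[unfolded strategies2_def] out] True show ?thesis
        by (simp add: \<gamma>_def)
    next
      case False
      with PiE_arb[OF \<gamma>0_strategies(2)[unfolded strategies2_def] p] show ?thesis
        by (simp add: \<gamma>_def)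
    qed
  qed
  ultimately have \<gamma>: "\<gamma> \<in> profiles G \<epsilon>" by (metis mem_Times_iff profiles_def)
  have closed: "edges G `` D \<subseteq> D" by (auto simp: D_def intro: rtrancl_into_rtrancl)
  have "equilibrium_at G \<epsilon> \<gamma> x" if x: "x \<in> D" for x
  proof -
    have jx: "j x \<in> states G" "(j x, x) \<in> (edges G)\<^sup>*" using j[OF x] M by auto
    \<comment> \<open>Subgame perfection of the given profile applies at \<open>x\<close>, a state
      of the subgame at \<open>j x\<close>; the nested subgame is then identified with
      \<open>subgame G x\<close>.\<close>
    have "equilibrium_at (subgame G (j x)) \<epsilon> (\<gamma>s (j x)) x"
      using sub j[OF x] by (auto simp: PSPE_iff)
    then show ?thesis
      using j[OF x] subgame_profile_subgame_profile[OF G jx, of \<epsilon> \<gamma>]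
      by (simp add: equilibrium_at_def subgame_subgame[OF G jx] sub_\<gamma>)
  qed
  then obtain \<gamma>' where \<gamma>': "PSPE G \<epsilon> \<gamma>'"
    and ext: "\<And>p. fst p \<in> D \<Longrightarrow> fst \<gamma>' p = fst \<gamma> p \<and> snd \<gamma>' p = snd \<gamma> p"
    using extend_equilibrium[OF G \<epsilon> \<gamma> closed] by auto
  have "subgame_profile G \<epsilon> \<gamma>' s = \<gamma>s s" if s: "s \<in> ?M" for s
  proof -
    have "subgame_profile G \<epsilon> \<gamma>' s = subgame_profile G \<epsilon> \<gamma> s"
      using s by (intro subgame_profile_cong ext) (auto simp: positions_def D_def)
    then show ?thesis using sub_\<gamma>[OF s] by simp
  qed
  then show "\<exists>\<gamma>'. PSPE G \<epsilon> \<gamma>' \<and> (\<forall>s\<in>?M. subgame_profile G \<epsilon> \<gamma>' s = \<gamma>s s)" using \<gamma>' by blast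
qed

end
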